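(* Let $G$ be a non-conservative $n$-bit reversible gate, let $k\ge2$ be an integer, and suppose $G(x)\cdot G(y)\equiv x\cdot y\pmod k$ for all $x,y\in\{0,1\}^n$. Then $k=2$.
   Context: An $n$-bit reversible gate is a permutation of $\{0,1\}^n$. It is conservative if $|G(x)|=|x|$ for all $x$, where $|x|$ is the Hamming weight, and non-conservative otherwise. $x\cdot y$ denotes the integer $x_1y_1+\cdots+x_ny_n$. *)

theory Defs
  imports Complex_Main "HOL-Number_Theory.Cong"
begin

(* The cube {0,1}^n is the set of boolean lists of length n (True is 1), so that n is an
   ordinary natural number.  All notions below look at a gate G only on this set; its
   values on lists of other lengths are irrelevant. *)
definition bitstrings :: "nat \<Rightarrow> bool list set" where
  "bitstrings n = {x. length x = n}"

definition hamming_weight :: "bool list \<Rightarrow> nat" where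
  "hamming_weight x = card {i. i < length x \<and> x ! i}"

(* The integer inner product; only used for lists of equal length. *)
definition inner_prod :: "bool list \<Rightarrow> bool list \<Rightarrow> nat" where
  "inner_prod x y = (\<Sum>i<length x. of_bool (x ! i) * of_bool (y ! i))"

definition reversible_gate :: "nat \<Rightarrow> (bool list \<Rightarrow> bool list) \<Rightarrow> bool" where
  "reversible_gate n G \<longleftrightarrow> bij_betw G (bitstrings n) (bitstrings n)"

definition conservative :: "nat \<Rightarrow> (bool list \<Rightarrow> bool list) \<Rightarrow> bool" where
  "conservative n G \<longleftrightarrow> (\<forall>x\<in>bitstrings n. hamming_weight (G x) = hamming_weight x)"

end

theory Submission
  imports Defs
begin

text \<open>
  Suppose \<open>k \<ge> 3\<close>. Every standard basis vector is \<open>G u\<close> for some \<open>u\<close>, so pairing with \<open>G u\<close> shows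
  that \<open>G\<close> is additive modulo \<open>k\<close> in each coordinate: if \<open>z = x + y\<close> is again a bit string, then
  \<open>G z \<equiv> G x + G y\<close>. Both sides have entries in \<open>{0, 1, 2}\<close>, the left one in \<open>{0, 1}\<close>, so this is an
  equality, and \<open>|G z| = |G x| + |G y|\<close>. As \<open>|G e| \<equiv> 1\<close> for basis vectors \<open>e\<close>, additivity gives
  \<open>|G x| \<ge> |x|\<close>. For \<open>x\<close> and its complement these lower bounds add up to \<open>n\<close>, while the weights
  of the images add up to at most \<open>n\<close>; hence \<open>G\<close> is conservative.
\<close>

definition unit_string :: "nat \<Rightarrow> nat \<Rightarrow> bool list" where
  "unit_string n i = (replicate n False)[i := True]"

lemma length_unit_string [simp]: "length (unit_string n i) = n"
  by (simp add: unit_string_def)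

lemma nth_unit_string: "j < n \<Longrightarrow> unit_string n i ! j \<longleftrightarrow> j = i"
  by (cases "j = i") (simp_all add: unit_string_def)

lemma hamming_weight_eq_sum: "hamming_weight x = (\<Sum>i<length x. of_bool (x ! i))"
proof -
  have "(\<Sum>i<length x. of_bool (x ! i) :: nat) = card ({..<length x} \<inter> {i. x ! i})"
    by (simp add: sum_of_bool_eq)
  also have "{..<length x} \<inter> {i. x ! i} = {i. i < length x \<and> x ! i}"
    by auto
  finally show ?thesis
    by (simp add: hamming_weight_def)
qed

lemma hamming_weight_le_length: "hamming_weight x \<le> length x"
  unfolding hamming_weight_eq_sum
  using sum_mono[of "{..<length x}" "\<lambda>i. of_bool (x ! i)" "\<lambda>_. 1::nat"] by simp

lemma inner_prod_self: "inner_prod x x = hamming_weight x"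
  unfolding inner_prod_def hamming_weight_eq_sum by (intro sum.cong) auto

lemma inner_prod_unit_string:
  assumes "length x = n" "i < n"
  shows "inner_prod x (unit_string n i) = of_bool (x ! i)"
proof -
  have "inner_prod x (unit_string n i) = (\<Sum>j<n. if j = i then of_bool (x ! i) else 0)"
    unfolding inner_prod_def using assms by (intro sum.cong) (auto simp: nth_unit_string)
  then show ?thesis
    using assms by simp
qed

lemma hamming_weight_unit_string:
  assumes "i < n"
  shows "hamming_weight (unit_string n i) = 1"
  using inner_prod_unit_string[of "unit_string n i" n i] assms
  by (simp add: inner_prod_self nth_unit_string)

text \<open>A relation, since the sum of two bit strings is in general not a bit string. The
  equation is taken in \<open>nat\<close>, so it forces disjoint supports.\<close>

definition is_sum :: "nat \<Rightarrow> bool list \<Rightarrow> bool list \<Rightarrow> bool list \<Rightarrow> bool" where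
  "is_sum n x y z \<longleftrightarrow> length x = n \<and> length y = n \<and> length z = n \<and>
     (\<forall>i<n. of_bool (z ! i) = (of_bool (x ! i) + of_bool (y ! i) :: nat))"

lemma hamming_weight_is_sum:
  "is_sum n x y z \<Longrightarrow> hamming_weight z = hamming_weight x + hamming_weight y"
  by (simp add: is_sum_def hamming_weight_eq_sum sum.distrib del: sum_of_bool_eq)

lemma inner_prod_is_sum:
  "is_sum n x y z \<Longrightarrow> inner_prod z u = inner_prod x u + inner_prod y u"
  by (simp add: is_sum_def inner_prod_def distrib_right sum.distrib)

lemma is_sum_complement: "is_sum n x (map Not x) (replicate n True)" if "length x = n"
  using that by (simp add: is_sum_def)

lemma is_sum_remove: "is_sum n (x[i := False]) (unit_string n i) x"
  if "length x = n" "i < n" "x ! i"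
  using that by (auto simp: is_sum_def nth_unit_string nth_list_update)

text \<open>Both sides are at most 2, hence already reduced modulo \<open>k\<close>. This is where
  \<open>k = 2\<close> drops out: there 0 is congruent to 1 + 1.\<close>

lemma of_bool_cong_add_imp_eq:
  fixes k :: nat
  assumes "k \<ge> 3" and "[of_bool c = of_bool a + of_bool b] (mod k)"
  shows "of_bool c = (of_bool a + of_bool b :: nat)"
proof -
  have "of_bool c < k" "of_bool a + of_bool b < k"
    using assms(1) by (auto simp: of_bool_def)
  with assms(2) show ?thesis
    by (simp add: cong_def)
qed

context
  fixes n k :: nat and G :: "bool list \<Rightarrow> bool list"
  assumes reversible: "reversible_gate n G"
    and k_ge_3: "k \<ge> 3"
    and preserves: "\<And>x y. length x = n \<Longrightarrow> length y = n \<Longrightarrow>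
           [inner_prod (G x) (G y) = inner_prod x y] (mod k)"
begin

lemma length_gate: "length x = n \<Longrightarrow> length (G x) = n"
  using reversible by (auto simp: reversible_gate_def bij_betw_def bitstrings_def)

lemma is_sum_gate:
  assumes "is_sum n x y z"
  shows "is_sum n (G x) (G y) (G z)"
proof -
  have len: "length x = n" "length y = n" "length z = n"
    using assms by (auto simp: is_sum_def)
  have "of_bool (G z ! i) = (of_bool (G x ! i) + of_bool (G y ! i) :: nat)" if "i < n" for i
  proof -
    have "unit_string n i \<in> G ` bitstrings n"
      using reversible by (simp add: reversible_gate_def bij_betw_def bitstrings_def)
    then obtain u where u: "length u = n" "G u = unit_string n i"
      by (auto simp: bitstrings_def)
    \<comment> \<open>Pairing \<open>G w\<close> with \<open>G u\<close> reads off bit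
      \<open>i\<close> of \<open>G w\<close>; preservation turns this into
      \<open>inner_prod w u\<close>, which is additive in \<open>w\<close>.\<close>
    have coord: "[of_bool (G w ! i) = inner_prod w u] (mod k)" if "length w = n" for w
      using preserves[OF that u(1)] that \<open>i < n\<close>
      by (simp add: u inner_prod_unit_string length_gate)
    have "[of_bool (G z ! i) = inner_prod x u + inner_prod y u] (mod k)"
      using coord[OF len(3)] inner_prod_is_sum[OF assms] by simp
    also have "[inner_prod x u + inner_prod y u = of_bool (G x ! i) + of_bool (G y ! i)] (mod k)"
      by (intro cong_add cong_sym[OF coord] len)
    finally show ?thesis
      by (rule of_bool_cong_add_imp_eq[OF k_ge_3])
  qed
  with len show ?thesis
    by (simp add: is_sum_def length_gate)
qed

text \<open>The weight is the inner product of a string with itself, so here it is 1 modulo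
  \<open>k\<close> and cannot vanish.\<close>

lemma hamming_weight_gate_unit_string:
  assumes "i < n"
  shows "hamming_weight (G (unit_string n i)) \<ge> 1"
proof -
  have "[hamming_weight (G (unit_string n i)) = 1] (mod k)"
    using preserves[of "unit_string n i" "unit_string n i"] assms
    by (simp add: inner_prod_self hamming_weight_unit_string)
  then have "hamming_weight (G (unit_string n i)) \<noteq> 0"
    using k_ge_3 by (intro notI) (simp add: cong_def)
  then show ?thesis
    by simp
qed

text \<open>Induction on the weight: clearing one set bit splits off a unit string, whose image adds
  at least 1 to the weight of \<open>G x\<close>.\<close>

lemma hamming_weight_gate_ge:
  assumes "length x = n"
  shows "hamming_weight x \<le> hamming_weight (G x)"
  using assms
proof (induction "hamming_weight x" arbitrary: x)
  case 0
  then show ?case by simp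
next
  case (Suc m)
  then have "{i. i < n \<and> x ! i} \<noteq> {}"
    by (metis card.empty hamming_weight_def nat.distinct(1))
  then obtain i where i: "i < n" "x ! i"
    by blast
  note split = is_sum_remove[OF \<open>length x = n\<close> i]
  have weight: "hamming_weight x = hamming_weight (x[i := False]) + 1"
    using hamming_weight_is_sum[OF split] hamming_weight_unit_string[OF i(1)] by simp
  then have "hamming_weight (x[i := False]) \<le> hamming_weight (G (x[i := False]))"
    using Suc by simp
  then show ?case
    using weight hamming_weight_is_sum[OF is_sum_gate[OF split]]
      hamming_weight_gate_unit_string[OF i(1)] by simp
qed

lemma conservative_gate: "conservative n G"
  unfolding conservative_def
proof
  fix x assume "x \<in> bitstrings n"
  then have x: "length x = n"
    by (simp add: bitstrings_def)
  note split = is_sum_complement[OF x]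
  \<comment> \<open>The two images add up to the image of the all-\<open>True\<close> string, which
    has length \<open>n\<close>.\<close>
  have "hamming_weight (G x) + hamming_weight (G (map Not x)) \<le> n"
    using hamming_weight_is_sum[OF is_sum_gate[OF split]]
      hamming_weight_le_length[of "G (replicate n True)"] by (simp add: length_gate)
  moreover have "hamming_weight x + hamming_weight (map Not x) = n"
    using hamming_weight_is_sum[OF split] by (simp add: hamming_weight_eq_sum[of "replicate n True"] del: sum_of_bool_eq)
  moreover have "hamming_weight x \<le> hamming_weight (G x)"
    "hamming_weight (map Not x) \<le> hamming_weight (G (map Not x))"
    using x by (simp_all add: hamming_weight_gate_ge)
  \<comment> \<open>Two lower bounds with total \<open>n\<close> against an upper bound
    \<open>n\<close>: both are attained.\<close>
  ultimately show "hamming_weight (G x) = hamming_weight x"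
    by linarith
qed

end

theorem theorem13:
  fixes n k :: nat and G :: "bool list \<Rightarrow> bool list"
  assumes "reversible_gate n G"
    and "\<not> conservative n G"
    and "k \<ge> 2"
    and "\<And>x y. x \<in> bitstrings n \<Longrightarrow> y \<in> bitstrings n \<Longrightarrow>
           [inner_prod (G x) (G y) = inner_prod x y] (mod k)"
  shows "k = 2"
proof (rule ccontr)
  assume "k \<noteq> 2"
  with \<open>k \<ge> 2\<close> have "k \<ge> 3"
    by simp
  then have "conservative n G"
    using conservative_gate[OF assms(1)] assms(4) by (simp add: bitstrings_def)
  with assms(2) show False ..
qed

end
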